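(* Let $\mathcal{C}$ be a combinatorial class with a composition rule $\blacktriangleleft\,:\mathcal{C}\times\mathcal{C}\to\mathrm{MSet}(\mathcal{C})$, let $\mathbb{K}$ be a field, and let $\mathscr{C}=\mathbb{K}\,\mathcal{C}$ be the $\mathbb{K}$-vector space of finite linear combinations of elements of $\mathcal{C}$ (with basis $\mathcal{C}$). Suppose that: (i) (Finiteness) for all $\Gamma_2,\Gamma_1\in\mathcal{C}$ the multiset $\Gamma_2\blacktriangleleft\Gamma_1$ is finite; (ii) (Triple composition) for all $\Gamma_3,\Gamma_2,\Gamma_1\in\mathcal{C}$, $\Gamma_3\blacktriangleleft(\Gamma_2\blacktriangleleft\Gamma_1)=(\Gamma_3\blacktriangleleft\Gamma_2)\blacktriangleleft\Gamma_1$ as multisets; (iii) (Neutral object) there is an object $\text{\O}\in\mathcal{C}$ such that $\text{\O}\blacktriangleleft\Gamma=\{\Gamma\}$ and $\Gamma\blacktriangleleft\text{\O}=\{\Gamma\}$ for every $\Gamma\in\mathcal{C}$. Then $\mathscr{C}$ with the bilinear multiplication $*:\mathscr{C}\times\mathscr{C}\to\mathscr{C}$ defined on basis elements by $$\Gamma_2*\Gamma_1=\sum_{\Gamma\in\Gamma_2\blacktriangleleft\Gamma_1}\Gamma$$ (sum over the multiset, i.e. counted with multiplicity) is an associative algebra with unit $(\mathscr{C},+,*,\text{\O})$. If moreover $\Gamma_2\blacktriangleleft\Gamma_1=\Gamma_1\blacktriangleleft\Gamma_2$ for all $\Gamma_2,\Gamma_1\in\mathcal{C}$, then this algebra is comm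utative.
   Context: A multiset is a pair $(A,m)$ with $A$ a set and $m:A\to\mathbb{N}_{\geq 1}$ a multiplicity function; equality of multisets means equality of underlying sets and of multiplicities. The sum $\uplus$ of multisets adds multiplicities. Sums over multisets count elements with multiplicity. A combinatorial class $\mathcal{C}$ is a denumerable collection of objects. $\mathrm{MSet}(\mathcal{C})$ denotes the class of multisets of elements of $\mathcal{C}$. A composition rule is a mapping $\blacktriangleleft\,:\mathcal{C}\times\mathcal{C}\to\mathrm{MSet}(\mathcal{C})$, assigning to $(\Gamma_2,\Gamma_1)$ the multiset $\Gamma_2\blacktriangleleft\Gamma_1$ of all possible compositions of $\Gamma_2$ with $\Gamma_1$. It is extended to multisets $A,B\in\mathrm{MSet}(\mathcal{C})$ by $A\blacktriangleleft B=\biguplus_{a\in A,\,b\in B}a\blacktriangleleft b$ (with elements counted with multiplicity); a single object $\Gamma$ is identified with the singleton multiset $\{\Gamma\}$ in such expressions. *)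

theory Defs
  imports Complex_Main "HOL-Library.Poly_Mapping" "HOL-Library.Countable"
begin

text \<open>
  A multiset is encoded by its multiplicity function, extended by 0 outside the underlying set.
  Unlike in \<open>HOL-Library.Multiset\<close>, the underlying set may be infinite, so that finiteness
  is a property of a composition rule and not part of its type.
\<close>

type_synonym 'c mset_fun = "'c \<Rightarrow> nat"

definition supp :: "'c mset_fun \<Rightarrow> 'c set" where
  "supp A = {x. A x > 0}"

definition msingle :: "'c \<Rightarrow> 'c mset_fun" where
  "msingle x = (\<lambda>y. if y = x then 1 else 0)"

text \<open>
  The multiplicity of \<open>z\<close> in the sum of all \<open>cr a b\<close>, where the pair \<open>(a, b)\<close> is counted
  \<open>A a * B b\<close> times. Only the pairs that contribute to the multiplicity of \<open>z\<close> are
  summed over; if there are infinitely many of them then the multiset sum has no multiplicity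
  function with values in the natural numbers, and the value 0 returned here is a dummy.
\<close>

definition comp_ext ::
    "('c \<Rightarrow> 'c \<Rightarrow> 'c mset_fun) \<Rightarrow> 'c mset_fun \<Rightarrow> 'c mset_fun \<Rightarrow> 'c mset_fun" where
  "comp_ext cr A B = (\<lambda>z.
     \<Sum>(a, b) \<in> {(a, b). a \<in> supp A \<and> b \<in> supp B \<and> z \<in> supp (cr a b)}.
       A a * B b * cr a b z)"

text \<open>
  The space of finite linear combinations of elements of \<open>'c\<close> over the field \<open>'k\<close> is the type
  \<open>'c \<Rightarrow>\<^sub>0 'k\<close>. The multiplication that \<open>HOL-Library.Poly_Mapping\<close> provides for this
  type (convolution with respect to addition on \<open>'c\<close>) is not used.
\<close>

definition lc_scale :: "'k::field \<Rightarrow> ('c \<Rightarrow>\<^sub>0 'k) \<Rightarrow> ('c \<Rightarrow>\<^sub>0 'k)" where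
  "lc_scale k p = Poly_Mapping.map ((*) k) p"

definition lc_basis :: "'c \<Rightarrow> ('c \<Rightarrow>\<^sub>0 'k::field)" where
  "lc_basis x = Poly_Mapping.single x 1"

text \<open>The sum of the elements of a finite multiset, counted with multiplicity.\<close>

definition mset_lc :: "'c mset_fun \<Rightarrow> ('c \<Rightarrow>\<^sub>0 'k::field)" where
  "mset_lc A = (\<Sum>x \<in> supp A. lc_scale (of_nat (A x)) (lc_basis x))"

text \<open>The bilinear extension of \<open>(a, b) \<mapsto> mset_lc (cr a b)\<close>.\<close>

definition comp_mult ::
    "('c \<Rightarrow> 'c \<Rightarrow> 'c mset_fun) \<Rightarrow> ('c \<Rightarrow>\<^sub>0 'k::field) \<Rightarrow> ('c \<Rightarrow>\<^sub>0 'k) \<Rightarrow> ('c \<Rightarrow>\<^sub>0 'k)" where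
  "comp_mult cr p q =
     (\<Sum>a \<in> Poly_Mapping.keys p. \<Sum>b \<in> Poly_Mapping.keys q.
        lc_scale (Poly_Mapping.lookup p a * Poly_Mapping.lookup q b) (mset_lc (cr a b)))"

locale unital_assoc_algebra = vector_space scale
  for scale :: "'k::field \<Rightarrow> 'v::ab_group_add \<Rightarrow> 'v" +
  fixes mult :: "'v \<Rightarrow> 'v \<Rightarrow> 'v" and unit :: 'v
  assumes linear_mult_right: "Vector_Spaces.linear scale scale (\<lambda>y. mult x y)"
    and linear_mult_left: "Vector_Spaces.linear scale scale (\<lambda>x. mult x y)"
    and mult_assoc: "mult (mult x y) z = mult x (mult y z)"
    and mult_unit_left: "mult unit x = x"
    and mult_unit_right: "mult x unit = x"

text \<open>
  The following facts confirm that \<^const>\<open>comp_mult\<close> is the bilinear map with the prescribed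
  values on basis elements.
\<close>

lemma lookup_lc_scale [simp]:
  "Poly_Mapping.lookup (lc_scale k p) x = k * Poly_Mapping.lookup p x"
  by (simp add: lc_scale_def map.rep_eq when_def)

lemma vector_space_lc_scale:
  "vector_space (lc_scale :: 'k::field \<Rightarrow> ('c \<Rightarrow>\<^sub>0 'k) \<Rightarrow> _)"
  by unfold_locales (auto intro!: poly_mapping_eqI simp: lookup_add algebra_simps)

lemma comp_mult_basis: "comp_mult cr (lc_basis a) (lc_basis b) = mset_lc (cr a b)"
  by (auto intro!: poly_mapping_eqI simp: comp_mult_def lc_basis_def)

lemma comp_mult_superset:
  assumes "finite A" "finite B" "Poly_Mapping.keys p \<subseteq> A" "Poly_Mapping.keys q \<subseteq> B"
  shows "comp_mult cr p q = (\<Sum>a\<in>A. \<Sum>b\<in>B.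
    lc_scale (Poly_Mapping.lookup p a * Poly_Mapping.lookup q b) (mset_lc (cr a b)))"
proof -
  have z: "lc_scale 0 r = 0" for r :: "'a \<Rightarrow>\<^sub>0 'b"
    by (rule poly_mapping_eqI) simp
  have "comp_mult cr p q = (\<Sum>a\<in>Poly_Mapping.keys p. \<Sum>b\<in>B.
      lc_scale (Poly_Mapping.lookup p a * Poly_Mapping.lookup q b) (mset_lc (cr a b)))"
    unfolding comp_mult_def using assms
    by (intro sum.cong refl sum.mono_neutral_left) (auto simp: z in_keys_iff)
  also have "\<dots> = (\<Sum>a\<in>A. \<Sum>b\<in>B.
      lc_scale (Poly_Mapping.lookup p a * Poly_Mapping.lookup q b) (mset_lc (cr a b)))"
    using assms by (intro sum.mono_neutral_left) (auto simp: z in_keys_iff)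
  finally show ?thesis .
qed

lemma comp_mult_linear_left: "Vector_Spaces.linear lc_scale lc_scale (\<lambda>p. comp_mult cr p q)"
proof -
  interpret vector_space lc_scale by (rule vector_space_lc_scale)
  have add: "comp_mult cr (p + p') q = comp_mult cr p q + comp_mult cr p' q" for p p'
  proof -
    let ?A = "Poly_Mapping.keys p \<union> Poly_Mapping.keys p'" and ?B = "Poly_Mapping.keys q"
    have "Poly_Mapping.keys (p + p') \<subseteq> ?A" by (rule keys_add)
    then show ?thesis
      by (simp add: comp_mult_superset[of ?A ?B] lookup_add distrib_right scale_left_distrib
          sum.distrib)
  qed
  have scale: "comp_mult cr (lc_scale k p) q = lc_scale k (comp_mult cr p q)" for k p
  proof -
    have "Poly_Mapping.keys (lc_scale k p) \<subseteq> Poly_Mapping.keys p" by (auto simp: in_keys_iff)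
    then show ?thesis
      by (simp add: comp_mult_superset[of "Poly_Mapping.keys p" "Poly_Mapping.keys q"]
          scale_sum_right mult.assoc)
  qed
  show ?thesis
    by (intro Vector_Spaces.linear_iff[THEN iffD2] conjI allI vector_space_lc_scale add scale)
qed

lemma comp_mult_flip: "comp_mult cr p q = comp_mult (\<lambda>a b. cr b a) q p"
  unfolding comp_mult_def by (subst sum.swap) (simp add: mult.commute)

lemma comp_mult_linear_right: "Vector_Spaces.linear lc_scale lc_scale (\<lambda>q. comp_mult cr p q)"
  by (subst comp_mult_flip) (rule comp_mult_linear_left)

end

theory Submission imports Defs begin

text \<open>
  The map sending a finite multiset to the sum of its elements turns the composition of
  multisets into multiplication: both \<^term>\<open>comp_mult cr (mset_lc A) (mset_lc B)\<close> and
  \<^term>\<open>mset_lc (comp_ext cr A B)\<close> have at \<open>z\<close> the coefficient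
  \<open>\<Sum>a b. A a * B b * cr a b z\<close> (lemma \<open>comp_mult_mset_lc\<close>). A basis element is the image of
  a singleton multiset, so the hypotheses on triple compositions and on the neutral object become
  associativity and the unit laws on basis elements. All these laws are linear in each
  argument, so they extend from the basis to the whole space (lemma \<open>linear_eq_if_eq_on_basis\<close>).
  Commutativity is immediate, since exchanging the factors of a product amounts to exchanging the
  arguments of the composition rule.
\<close>

lemma supp_msingle [simp]: "supp (msingle x) = {x}"
  by (auto simp: supp_def msingle_def)

lemma lookup_mset_lc:
  assumes "finite (supp A)"
  shows "Poly_Mapping.lookup (mset_lc A) x = of_nat (A x)"
proof -
  have "Poly_Mapping.lookup (mset_lc A) x
      = (\<Sum>y\<in>supp A. of_nat (A y) * Poly_Mapping.lookup (lc_basis y) x)"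
    by (simp add: mset_lc_def lookup_sum)
  also have "\<dots> = (\<Sum>y\<in>supp A. if y = x then of_nat (A x) else 0)"
    by (intro sum.cong) (auto simp: lc_basis_def lookup_single when_def)
  finally show ?thesis
    using assms by (cases "A x = 0") (auto simp: supp_def)
qed

lemma keys_mset_lc:
  assumes "finite (supp A)"
  shows "Poly_Mapping.keys (mset_lc A) \<subseteq> supp A"
  using assms by (auto simp: in_keys_iff lookup_mset_lc supp_def intro: gr0I)

lemma mset_lc_msingle: "mset_lc (msingle x) = lc_basis x"
  by (rule poly_mapping_eqI)
    (simp add: lookup_mset_lc, simp add: lc_basis_def lookup_single when_def msingle_def)

text \<open>
  For finite multisets, restricting the sum to the contributing pairs only drops zero terms.
\<close>

lemma comp_ext_finite:
  assumes "finite (supp A)" "finite (supp B)"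
  shows "comp_ext cr A B z = (\<Sum>a\<in>supp A. \<Sum>b\<in>supp B. A a * B b * cr a b z)"
proof -
  have "comp_ext cr A B z = (\<Sum>(a, b)\<in>supp A \<times> supp B. A a * B b * cr a b z)"
    unfolding comp_ext_def using assms
    by (intro sum.mono_neutral_left) (auto simp: supp_def)
  then show ?thesis
    by (simp add: sum.cartesian_product)
qed

lemma finite_supp_comp_ext:
  assumes "\<And>a b. finite (supp (cr a b))" "finite (supp A)" "finite (supp B)"
  shows "finite (supp (comp_ext cr A B))"
proof (rule finite_subset)
  show "supp (comp_ext cr A B) \<subseteq> (\<Union>a\<in>supp A. \<Union>b\<in>supp B. supp (cr a b))"
  proof
    fix z
    assume "z \<in> supp (comp_ext cr A B)"
    then have "comp_ext cr A B z \<noteq> 0"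
      by (simp add: supp_def)
    then have "(\<Sum>a\<in>supp A. \<Sum>b\<in>supp B. A a * B b * cr a b z) \<noteq> 0"
      unfolding comp_ext_finite[OF assms(2,3)] .
    then obtain a b where "a \<in> supp A" "b \<in> supp B" "A a * B b * cr a b z \<noteq> 0"
      by (meson sum.neutral)
    then show "z \<in> (\<Union>a\<in>supp A. \<Union>b\<in>supp B. supp (cr a b))"
      by (auto simp: supp_def)
  qed
qed (use assms in auto)

text \<open>
  Composition of multisets is bilinear in the multiplicities, with the same structure constants
  \<^term>\<open>cr a b z\<close> as the multiplication of linear combinations.
\<close>

lemma comp_mult_mset_lc:
  assumes cr: "\<And>a b. finite (supp (cr a b))"
    and A: "finite (supp A)" and B: "finite (supp B)"
  shows "comp_mult cr (mset_lc A) (mset_lc B) = mset_lc (comp_ext cr A B)"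
proof (rule poly_mapping_eqI)
  fix z
  have "Poly_Mapping.lookup (comp_mult cr (mset_lc A) (mset_lc B)) z
      = (\<Sum>a\<in>supp A. \<Sum>b\<in>supp B. of_nat (A a) * of_nat (B b) * of_nat (cr a b z))"
    by (simp add: comp_mult_superset[OF A B keys_mset_lc[OF A] keys_mset_lc[OF B]] lookup_sum
        lookup_mset_lc assms)
  also have "\<dots> = of_nat (comp_ext cr A B z)"
    by (simp add: comp_ext_finite A B)
  also have "\<dots> = Poly_Mapping.lookup (mset_lc (comp_ext cr A B)) z"
    by (simp add: lookup_mset_lc finite_supp_comp_ext assms)
  finally show "Poly_Mapping.lookup (comp_mult cr (mset_lc A) (mset_lc B)) z
      = Poly_Mapping.lookup (mset_lc (comp_ext cr A B)) z" .
qed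

lemma sum_basis_expansion:
  "p = (\<Sum>a\<in>Poly_Mapping.keys p. lc_scale (Poly_Mapping.lookup p a) (lc_basis a))"
  by (rule poly_mapping_eqI)
    (simp add: lookup_sum lc_basis_def lookup_single when_def in_keys_iff if_distrib[of "(*) _"]
      cong: if_cong)

lemma linear_eq_if_eq_on_basis:
  assumes f: "Vector_Spaces.linear lc_scale scale f"
    and g: "Vector_Spaces.linear lc_scale scale g"
    and eq: "\<And>a. f (lc_basis a) = g (lc_basis a)"
  shows "f p = g p"
proof -
  interpret f: Vector_Spaces.linear lc_scale scale f by (rule f)
  interpret g: Vector_Spaces.linear lc_scale scale g by (rule g)
  have "f (\<Sum>a\<in>Poly_Mapping.keys p. lc_scale (Poly_Mapping.lookup p a) (lc_basis a))
      = g (\<Sum>a\<in>Poly_Mapping.keys p. lc_scale (Poly_Mapping.lookup p a) (lc_basis a))"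
    by (simp add: f.sum g.sum f.scale g.scale eq)
  then show ?thesis
    by (simp flip: sum_basis_expansion)
qed

text \<open>
  Both bracketings are linear in each of the three arguments, so each argument in turn can be
  freed from being a basis element.
\<close>

lemma comp_mult_assoc_if_assoc_on_basis:
  fixes x y z :: "'c \<Rightarrow>\<^sub>0 'k::field"
  assumes basis: "\<And>a b c. comp_mult cr (comp_mult cr (lc_basis a) (lc_basis b)) (lc_basis c)
    = comp_mult cr (lc_basis a :: 'c \<Rightarrow>\<^sub>0 'k) (comp_mult cr (lc_basis b) (lc_basis c))"
  shows "comp_mult cr (comp_mult cr x y) z = comp_mult cr x (comp_mult cr y z)"
proof -
  note comp = Vector_Spaces.linear_compose[unfolded o_def]
  have 1: "comp_mult cr (comp_mult cr (lc_basis a) (lc_basis b)) z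
      = comp_mult cr (lc_basis a) (comp_mult cr (lc_basis b) z)" for a b and z :: "'c \<Rightarrow>\<^sub>0 'k"
    by (rule linear_eq_if_eq_on_basis[OF comp_mult_linear_right
          comp[OF comp_mult_linear_right comp_mult_linear_right]]) (rule basis)
  have 2: "comp_mult cr (comp_mult cr (lc_basis a) y) z
      = comp_mult cr (lc_basis a) (comp_mult cr y z)" for a and y z :: "'c \<Rightarrow>\<^sub>0 'k"
    by (rule linear_eq_if_eq_on_basis[OF comp[OF comp_mult_linear_right comp_mult_linear_left]
          comp[OF comp_mult_linear_left comp_mult_linear_right]]) (rule 1)
  show ?thesis
    by (rule linear_eq_if_eq_on_basis[OF comp[OF comp_mult_linear_left comp_mult_linear_left]
          comp_mult_linear_left]) (rule 2)
qed

theorem proposition1: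
  fixes cr :: "'c::countable \<Rightarrow> 'c \<Rightarrow> 'c mset_fun" and neutral :: 'c
  assumes finiteness: "\<And>\<Gamma>\<^sub>2 \<Gamma>\<^sub>1. finite (supp (cr \<Gamma>\<^sub>2 \<Gamma>\<^sub>1))"
    and triple: "\<And>\<Gamma>\<^sub>3 \<Gamma>\<^sub>2 \<Gamma>\<^sub>1. comp_ext cr (msingle \<Gamma>\<^sub>3) (cr \<Gamma>\<^sub>2 \<Gamma>\<^sub>1) =
                                 comp_ext cr (cr \<Gamma>\<^sub>3 \<Gamma>\<^sub>2) (msingle \<Gamma>\<^sub>1)"
    and neutral_left: "\<And>\<Gamma>. cr neutral \<Gamma> = msingle \<Gamma>"
    and neutral_right: "\<And>\<Gamma>. cr \<Gamma> neutral = msingle \<Gamma>"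
  shows "unital_assoc_algebra (lc_scale :: 'k::field \<Rightarrow> ('c \<Rightarrow>\<^sub>0 'k) \<Rightarrow> ('c \<Rightarrow>\<^sub>0 'k))
           (comp_mult cr) (lc_basis neutral) \<and>
         ((\<forall>\<Gamma>\<^sub>2 \<Gamma>\<^sub>1. cr \<Gamma>\<^sub>2 \<Gamma>\<^sub>1 = cr \<Gamma>\<^sub>1 \<Gamma>\<^sub>2) \<longrightarrow>
            (\<forall>x y :: 'c \<Rightarrow>\<^sub>0 'k. comp_mult cr x y = comp_mult cr y x))"
proof (intro conjI impI allI)
  let ?mult = "comp_mult cr :: ('c \<Rightarrow>\<^sub>0 'k) \<Rightarrow> ('c \<Rightarrow>\<^sub>0 'k) \<Rightarrow> ('c \<Rightarrow>\<^sub>0 'k)"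
  have fin: "finite (supp (msingle a))" for a :: 'c
    by simp
  have basis: "?mult (?mult (lc_basis a) (lc_basis b)) (lc_basis c)
      = ?mult (lc_basis a) (?mult (lc_basis b) (lc_basis c))" for a b c
  proof -
    have "?mult (?mult (lc_basis a) (lc_basis b)) (lc_basis c)
        = mset_lc (comp_ext cr (cr a b) (msingle c))"
      by (simp add: comp_mult_basis comp_mult_mset_lc[OF finiteness finiteness fin]
          flip: mset_lc_msingle[of c])
    also have "\<dots> = mset_lc (comp_ext cr (msingle a) (cr b c))"
      by (simp only: triple)
    also have "\<dots> = ?mult (lc_basis a) (?mult (lc_basis b) (lc_basis c))"
      by (simp add: comp_mult_basis comp_mult_mset_lc[OF finiteness fin finiteness]
          flip: mset_lc_msingle[of a])
    finally show ?thesis .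
  qed
  interpret vector_space "lc_scale :: 'k \<Rightarrow> ('c \<Rightarrow>\<^sub>0 'k) \<Rightarrow> _"
    by (rule vector_space_lc_scale)
  show "unital_assoc_algebra (lc_scale :: 'k \<Rightarrow> _) ?mult (lc_basis neutral)"
  proof (intro unital_assoc_algebra.intro unital_assoc_algebra_axioms.intro
      vector_space_lc_scale)
    fix x y z :: "'c \<Rightarrow>\<^sub>0 'k"
    show "Vector_Spaces.linear lc_scale lc_scale (?mult x)"
      by (rule comp_mult_linear_right)
    show "Vector_Spaces.linear lc_scale lc_scale (\<lambda>x. ?mult x y)"
      by (rule comp_mult_linear_left)
    show "?mult (?mult x y) z = ?mult x (?mult y z)"
      by (rule comp_mult_assoc_if_assoc_on_basis) (rule basis)
    show "?mult (lc_basis neutral) x = x"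
      by (rule linear_eq_if_eq_on_basis[OF comp_mult_linear_right linear_ident])
        (simp add: comp_mult_basis neutral_left mset_lc_msingle)
    show "?mult x (lc_basis neutral) = x"
      by (rule linear_eq_if_eq_on_basis[OF comp_mult_linear_left linear_ident])
        (simp add: comp_mult_basis neutral_right mset_lc_msingle)
  qed
next
  fix x y :: "'c \<Rightarrow>\<^sub>0 'k"
  assume "\<forall>\<Gamma>\<^sub>2 \<Gamma>\<^sub>1. cr \<Gamma>\<^sub>2 \<Gamma>\<^sub>1 = cr \<Gamma>\<^sub>1 \<Gamma>\<^sub>2"
  then have "(\<lambda>a b. cr b a) = cr"
    by blast
  then show "comp_mult cr x y = comp_mult cr y x"
    by (subst comp_mult_flip) simp
qed

end
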